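(* Let $p\neq5$ be an odd prime and let $L_p(X,Y)=\sum_{0\le i,j\le p+1}C_{i,j}X^iY^j\in\mathbb{Q}[X,Y]$ be the modular equation for $l(\tau)$ of level $p$, i.e. a nonzero polynomial of degree at most $p+1$ in each variable with $L_p(l(\tau),l(p\tau))=0$ identically in $\tau$. (1) If $p\equiv\pm1\pmod{10}$, then $C_{p+1,0}\neq0$, $C_{0,p+1}\neq0$, $C_{i,p+1}=C_{p+1,i}=0$ for $i\in\{1,\dots,p+1\}$, and $C_{0,j}=C_{j,0}=0$ for $j\in\{0,\dots,p\}$. (2) If $p\equiv\pm3\pmod{10}$, then $C_{p+1,p}\neq0$, $C_{0,1}\neq0$, $C_{1,p+1}\neq0$, $C_{p,0}\neq0$, $C_{p+1,i}=C_{i,0}=0$ for $i\in\{0,\dots,p-1,p+1\}$, and $C_{0,j}=C_{j,p+1}=0$ for $j\in\{0,2,3,\dots,p+1\}$.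
   Context: For $\tau\in\mathbb{H}$ put $q=e^{2\pi i\tau}$ and let $r(\tau)=q^{1/5}\prod_{n\ge1}\frac{(1-q^{5n-1})(1-q^{5n-4})}{(1-q^{5n-2})(1-q^{5n-3})}$ be the Rogers–Ramanujan continued fraction. Define $l(\tau)=r(2\tau)/r(\tau)^2$. *)

theory Defs
  imports
    "HOL-Analysis.Analysis"
    "HOL-Computational_Algebra.Polynomial"
    "HOL-Number_Theory.Cong"
begin

text \<open>The Rogers--Ramanujan continued fraction, meaningful for \<open>Im \<tau> > 0\<close>. The branch of
  \<open>q\<^bsup>1/5\<^esup>\<close> is \<open>exp (2 \<pi> i \<tau> / 5)\<close>. \<open>prodinf\<close> runs over \<open>k \<ge> 0\<close>, with \<open>n = Suc k\<close>;
  the subtractions on \<open>nat\<close> do not truncate.\<close>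

definition rr_cf :: "complex \<Rightarrow> complex" where
  "rr_cf \<tau> =
    (let q = exp (2 * of_real pi * \<i> * \<tau>) in
      exp (2 * of_real pi * \<i> * \<tau> / 5) *
      (\<Prod>k. let n = Suc k in
         ((1 - q ^ (5 * n - 1)) * (1 - q ^ (5 * n - 4))) /
         ((1 - q ^ (5 * n - 2)) * (1 - q ^ (5 * n - 3)))))"

definition rr_l :: "complex \<Rightarrow> complex" where
  "rr_l \<tau> = rr_cf (2 * \<tau>) / rr_cf \<tau> ^ 2"

text \<open>Elements of \<open>\<rat>[X,Y]\<close> are represented as \<open>\<rat>[X][Y]\<close>: the outer variable is \<open>Y\<close>,
  the inner one is \<open>X\<close>.\<close>

definition coeff2 :: "'a::zero poly poly \<Rightarrow> nat \<Rightarrow> nat \<Rightarrow> 'a" where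
  "coeff2 L i j = coeff (coeff L j) i"

definition eval2 :: "rat poly poly \<Rightarrow> complex \<Rightarrow> complex \<Rightarrow> complex" where
  "eval2 L x y = poly (map_poly (\<lambda>c. poly (map_poly of_rat c) x) L) y"

definition modular_equation_l :: "nat \<Rightarrow> rat poly poly \<Rightarrow> bool" where
  "modular_equation_l p L \<longleftrightarrow>
     L \<noteq> 0 \<and>
     degree L \<le> p + 1 \<and> (\<forall>j. degree (coeff L j) \<le> p + 1) \<and>
     (\<forall>\<tau>. Im \<tau> > 0 \<longrightarrow> eval2 L (rr_l \<tau>) (rr_l (of_nat p * \<tau>)) = 0)"

end

theory Submission
  imports Defs "HOL-Real_Asymp.Real_Asymp"
begin

text \<open>
  The claim is a statement about the Newton polygon of \<open>L\<close>, which is forced by the growth of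
  \<open>l\<close> at four cusps; neither the modularity of \<open>l\<close> nor the irreducibility of \<open>L\<close> is required.

  Taking logarithms and summing geometric series gives
  \<open>ln \<bar>r(x + iy)\<bar> = - 2 \<pi> y / 5 - Re (\<Sum>m\<ge>1. (w - w\<^sup>2 - w\<^sup>3 + w\<^sup>4) / (m (1 - w\<^sup>5)))\<close> with \<open>w = q\<^sup>m\<close>.
  Tannery's theorem evaluates the limit of \<open>y ln \<bar>r(x + iy)\<bar>\<close> as \<open>y \<rightarrow> 0\<close> at \<open>x = b/(5d)\<close>:
  only the \<open>m\<close> divisible by \<open>d\<close> contribute, each with a quadratic Gauss sum modulo 5. Hence
  \<open>y ln \<bar>l(x + iy)\<bar>\<close> tends to \<open>(b/5) K / d\<^sup>2\<close>, where \<open>(b/5)\<close> is the Legendre symbol and \<open>K > 0\<close>.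

  Approaching \<open>b/5\<close> and \<open>b/(5p)\<close> with \<open>b = 1, 2\<close>, the pair \<open>(ln \<bar>l(\<tau>)\<bar>, ln \<bar>l(p\<tau>)\<bar>)\<close> grows in the
  directions \<open>\<plusminus>(p, (p/5))\<close> and \<open>\<plusminus>(1, p)\<close>. In each of these four directions the maximal weight over
  the support of \<open>L\<close> must be attained twice, so the Newton polygon has edges with these normals.
  In the box \<open>[0, p+1]\<^sup>2\<close> there is room for exactly one such quadrilateral.
\<close>

section \<open>The logarithm of the Rogers--Ramanujan product\<close>

text \<open>Index \<open>m\<close> stands for the exponent \<open>Suc m\<close> of the logarithmic
  series. The signs in the numerator are the Legendre symbol modulo 5; this is a term of minus the
  logarithm of the product, already summed over all factors.\<close>

definition rr_term :: "complex \<Rightarrow> nat \<Rightarrow> complex" where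
  "rr_term q m = (let w = q ^ Suc m in (w - w ^ 2 - w ^ 3 + w ^ 4) / (1 - w ^ 5) / of_nat (Suc m))"

text \<open>The Mercator series, as an unordered sum so that it can enter a double sum over factors
  and exponents.\<close>

lemma has_sum_neg_Ln_one_minus:
  fixes z :: complex
  assumes "norm z < 1"
  shows "((\<lambda>m. z ^ Suc m / of_nat (Suc m)) has_sum - Ln (1 - z)) UNIV"
proof (rule norm_summable_imp_has_sum)
  show "summable (\<lambda>m. norm (z ^ Suc m / of_nat (Suc m)))"
  proof (rule summable_comparison_test')
    show "summable (\<lambda>m. norm z ^ m)" using assms by simp
    fix m :: nat
    have "norm z * norm z ^ m \<le> 1 * norm z ^ m"
      using assms by (intro mult_right_mono) auto
    also have "\<dots> \<le> norm z ^ m * real (Suc m)"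
      by (simp add: mult_le_cancel_left1 flip: of_nat_Suc)
    finally show "norm (norm (z ^ Suc m / of_nat (Suc m))) \<le> norm z ^ m"
      by (simp add: norm_divide norm_mult norm_power divide_simps del: of_nat_Suc)
  qed
  have "(\<lambda>n. - (z ^ n / of_nat n)) sums Ln (1 - z)"
    using Ln_series'[of "-z"] assms by simp
  from sums_minus[OF this] have "(\<lambda>n. z ^ n / of_nat n) sums (- Ln (1 - z))"
    by simp
  thus "(\<lambda>m. z ^ Suc m / of_nat (Suc m)) sums (- Ln (1 - z))"
    by (subst sums_Suc_iff) simp
qed

lemma has_sum_rr_term_inner:
  fixes w :: complex
  assumes "norm w < 1"
  shows "((\<lambda>k. w ^ (5 * k + 1) - w ^ (5 * k + 2) - w ^ (5 * k + 3) + w ^ (5 * k + 4))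
           has_sum (w - w ^ 2 - w ^ 3 + w ^ 4) / (1 - w ^ 5)) UNIV"
proof (rule norm_summable_imp_has_sum)
  have n5: "norm (w ^ 5) < 1"
    using assms by (simp add: norm_power power_less_one_iff)
  have eq: "w ^ (5 * k + 1) - w ^ (5 * k + 2) - w ^ (5 * k + 3) + w ^ (5 * k + 4)
     = (w - w ^ 2 - w ^ 3 + w ^ 4) * (w ^ 5) ^ k" for k
    unfolding power_add power_mult power_one_right
    by (simp only: left_diff_distrib distrib_right mult.commute[of "(w ^ 5) ^ k"])
  show "summable (\<lambda>k. norm (w ^ (5 * k + 1) - w ^ (5 * k + 2) - w ^ (5 * k + 3) + w ^ (5 * k + 4)))"
    unfolding eq norm_mult norm_power[of "w ^ 5"] using n5 by (intro summable_mult summable_geometric) auto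
  show "(\<lambda>k. w ^ (5 * k + 1) - w ^ (5 * k + 2) - w ^ (5 * k + 3) + w ^ (5 * k + 4)) sums
          ((w - w ^ 2 - w ^ 3 + w ^ 4) / (1 - w ^ 5))"
    unfolding eq using sums_mult[OF geometric_sums[OF n5], of "w - w ^ 2 - w ^ 3 + w ^ 4"] by simp
qed

text \<open>With \<open>a = norm w\<close>, the powers with exponent prime to 5 are part of the full
  geometric series \<open>a / (1 - a)\<close>. The divisor \<open>real (Suc m)\<close> is kept since
  it later supplies one of the two powers of \<open>Suc m\<close> in the dominating series.\<close>

lemma norm_rr_term_le:
  fixes q :: complex
  assumes "norm q < 1"
  shows "norm (rr_term q m) \<le> norm q ^ Suc m / (1 - norm q ^ Suc m) / real (Suc m)"
proof -
  define w where "w = q ^ Suc m"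
  define a where "a = norm w"
  have a: "a < 1" "a \<ge> 0" and aq: "a = norm q ^ Suc m"
    using assms by (simp_all add: a_def w_def norm_power power_less_one_iff del: power_Suc)
  have "norm (w - w ^ 2 - w ^ 3 + w ^ 4) \<le> a + a^2 + a^3 + a^4"
    unfolding a_def by (intro order_trans[OF norm_triangle_ineq] order_trans[OF norm_triangle_ineq4] add_mono)
      (simp_all add: norm_power)
  moreover have "1 - a ^ 5 \<le> norm (1 - w ^ 5)"
    using norm_triangle_ineq2[of 1 "w ^ 5"] by (simp add: norm_power a_def)
  moreover have "a ^ 5 < 1" using a by (simp add: power_less_one_iff)
  ultimately have "norm ((w - w ^ 2 - w ^ 3 + w ^ 4) / (1 - w ^ 5)) \<le> (a + a^2 + a^3 + a^4) / (1 - a ^ 5)"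
    unfolding norm_divide by (intro frac_le) (use a in auto)
  also have "\<dots> \<le> a / (1 - a)"
  proof -
    have "(a + a^2 + a^3 + a^4) * (1 - a) = a * (1 - a ^ 4)"
      by (simp add: algebra_simps power2_eq_square power3_eq_cube power4_eq_xxxx)
    also have "a ^ 5 \<le> a ^ 4" using a by (intro power_decreasing) auto
    then have "a * (1 - a ^ 4) \<le> a * (1 - a ^ 5)"
      using a by (intro mult_left_mono) auto
    finally show ?thesis using a \<open>a ^ 5 < 1\<close> by (simp add: divide_simps)
  qed
  finally show ?thesis
    unfolding rr_term_def Let_def w_def[symmetric] aq[symmetric] norm_divide[of _ "of_nat _"]
      norm_of_nat
    by (intro divide_right_mono) auto
qed

text \<open>The double family over factors \<open>k\<close> and exponents \<open>m\<close> is
  absolutely summable. Summing over \<open>m\<close> first gives logarithms of the factors, summing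
  over \<open>k\<close> first gives \<open>rr_term\<close>.\<close>

lemma rr_product_conv_exp:
  fixes q :: complex
  assumes q: "norm q < 1"
  shows "summable (rr_term q)"
    and "(\<Prod>k. let n = Suc k in
            ((1 - q ^ (5 * n - 1)) * (1 - q ^ (5 * n - 4))) /
            ((1 - q ^ (5 * n - 2)) * (1 - q ^ (5 * n - 3)))) = exp (- suminf (rr_term q))"
proof -
  define f :: "nat \<Rightarrow> nat \<Rightarrow> complex" where
    "f k m = ((q ^ Suc m) ^ (5 * k + 1) - (q ^ Suc m) ^ (5 * k + 2) - (q ^ Suc m) ^ (5 * k + 3)
       + (q ^ Suc m) ^ (5 * k + 4)) / of_nat (Suc m)" for k m
  \<comment> \<open>Principal logarithms suffice, as only \<open>exp (- g k)\<close> is compared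
    with the factor. The double minus signs match the form in which each logarithmic series is
    summed.\<close>
  define g where "g k = - Ln (1 - q ^ (5 * k + 1)) - - Ln (1 - q ^ (5 * k + 2))
      - - Ln (1 - q ^ (5 * k + 3)) + - Ln (1 - q ^ (5 * k + 4))" for k
  have lt: "norm (q ^ e) < 1" if "e > 0" for e
    using q that by (simp add: norm_power power_less_one_iff)
  have f_g: "(f k has_sum g k) UNIV" for k
  proof -
    have "f k = (\<lambda>m. (q ^ (5 * k + 1)) ^ Suc m / of_nat (Suc m) - (q ^ (5 * k + 2)) ^ Suc m / of_nat (Suc m)
       - (q ^ (5 * k + 3)) ^ Suc m / of_nat (Suc m) + (q ^ (5 * k + 4)) ^ Suc m / of_nat (Suc m))"
      unfolding f_def power_mult[symmetric] mult.commute[of "Suc _"]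
      by (simp only: diff_divide_distrib add_divide_distrib)
    moreover have "((\<lambda>m. (q ^ e) ^ Suc m / of_nat (Suc m)) has_sum - Ln (1 - q ^ e)) UNIV" if "e > 0" for e
      by (rule has_sum_neg_Ln_one_minus[OF lt[OF that]])
    ultimately show ?thesis unfolding g_def diff_conv_add_uminus
      by (simp only:) (intro has_sum_add has_sum_uminusI; simp only: zero_less_numeral zero_less_one add_pos_pos add_nonneg_pos zero_le)
  qed
  have f_rr: "((\<lambda>k. f k m) has_sum rr_term q m) UNIV" for m
  proof -
    have "norm (q ^ Suc m) < 1" using q by (simp add: norm_power power_less_one_iff del: power_Suc)
    from has_sum_rr_term_inner[OF this] show ?thesis
      unfolding f_def rr_term_def Let_def divide_inverse[of _ "of_nat (Suc m)"]
      by (rule has_sum_cmult_left)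
  qed
  \<comment> \<open>Every exponent of \<open>q\<close> in \<open>f k m\<close> is at least
    \<open>k + m\<close>, so a product of two geometric series dominates.\<close>
  have fbound: "norm (f k m) \<le> 4 * (norm q ^ k * norm q ^ m)" for k m
  proof -
    have b: "norm ((q ^ Suc m) ^ (5 * k + Suc i)) \<le> norm q ^ k * norm q ^ m" for i
      unfolding norm_power power_mult[symmetric] power_add[symmetric]
      using q by (intro power_decreasing) auto
    have "norm ((q ^ Suc m) ^ (5 * k + 1) - (q ^ Suc m) ^ (5 * k + 2) - (q ^ Suc m) ^ (5 * k + 3)
       + (q ^ Suc m) ^ (5 * k + 4)) \<le> norm q ^ k * norm q ^ m + norm q ^ k * norm q ^ m
         + norm q ^ k * norm q ^ m + norm q ^ k * norm q ^ m"
      using b[of 0] b[of 1] b[of 2] b[of 3]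
      by (intro order_trans[OF norm_triangle_ineq] order_trans[OF norm_triangle_ineq4] add_mono) 
         (simp_all add: numeral_eq_Suc)
    also have "\<dots> = 4 * (norm q ^ k * norm q ^ m)" by simp
    also have "\<dots> \<le> 4 * (norm q ^ k * norm q ^ m) * real (Suc m)"
      using mult_left_mono[of 1 "real (Suc m)" "4 * (norm q ^ k * norm q ^ m)"] by simp
    finally show ?thesis
      unfolding f_def norm_divide by (simp add: divide_simps del: of_nat_Suc power_Suc)
  qed
  have geo: "((\<lambda>m. norm q ^ m) has_sum 1 / (1 - norm q)) UNIV"
    using q by (intro norm_summable_imp_has_sum geometric_sums) auto
  have "(\<lambda>(k, m). 4 * (norm q ^ k * norm q ^ m)) summable_on UNIV \<times> UNIV"
  proof (rule summable_on_SigmaI)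
    show "((\<lambda>m. case (k, m) of (k, m) \<Rightarrow> 4 * (norm q ^ k * norm q ^ m)) has_sum
            4 * (norm q ^ k * (1 / (1 - norm q)))) UNIV" for k
      using has_sum_cmult_right[OF geo, of "4 * norm q ^ k"] by (simp add: mult_ac)
    have "((\<lambda>k. 4 * (1 / (1 - norm q)) * norm q ^ k) has_sum 4 * (1 / (1 - norm q)) * (1 / (1 - norm q))) UNIV"
      by (rule has_sum_cmult_right[OF geo])
    thus "(\<lambda>k. 4 * (norm q ^ k * (1 / (1 - norm q)))) summable_on UNIV"
      unfolding summable_on_def by (auto simp: mult_ac)
  qed auto
  hence "(\<lambda>x. norm (case x of (k, m) \<Rightarrow> f k m)) summable_on UNIV \<times> UNIV"
    by (rule summable_on_comparison_test) (use fbound in auto)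
  hence "(\<lambda>(k, m). f k m) summable_on UNIV \<times> UNIV"
    by (rule abs_summable_summable)
  then obtain S where S: "((\<lambda>(k, m). f k m) has_sum S) (UNIV \<times> UNIV)"
    by (auto simp: summable_on_def)
  have gS: "(g has_sum S) UNIV"
    by (rule has_sum_SigmaD[OF S]) (use f_g in auto)
  have "((\<lambda>(m, k). f k m) has_sum S) (UNIV \<times> UNIV)"
    using S by (subst has_sum_swap) simp
  hence "(rr_term q has_sum S) UNIV"
    by (rule has_sum_SigmaD) (use f_rr in auto)
  hence rS: "rr_term q sums S" by (rule has_sum_imp_sums)
  thus "summable (rr_term q)" by (auto simp: sums_iff)
  have "g sums S" by (rule has_sum_imp_sums[OF gS])
  hence "(\<Prod>k. exp (- g k)) = exp (- S)"
    using prodinf_exp[of "\<lambda>k. - g k"] by (simp add: sums_iff summable_minus suminf_minus)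
  moreover have "exp (- g k) = (let n = Suc k in
            ((1 - q ^ (5 * n - 1)) * (1 - q ^ (5 * n - 4))) /
            ((1 - q ^ (5 * n - 2)) * (1 - q ^ (5 * n - 3))))" for k
  proof -
    have nz: "1 - q ^ e \<noteq> 0" if "e > 0" for e using lt[OF that] by auto
    have e: "5 * Suc k - 1 = 5 * k + 4" "5 * Suc k - 4 = 5 * k + 1"
         "5 * Suc k - 2 = 5 * k + 3" "5 * Suc k - 3 = 5 * k + 2" by auto
    show ?thesis
      unfolding Let_def e g_def
      using nz[of "5 * k + 1"] nz[of "5 * k + 2"] nz[of "5 * k + 3"] nz[of "5 * k + 4"]
      by (simp add: exp_add exp_diff exp_minus field_simps del: power_Suc power_add)
  qed
  ultimately show "(\<Prod>k. let n = Suc k in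
            ((1 - q ^ (5 * n - 1)) * (1 - q ^ (5 * n - 4))) /
            ((1 - q ^ (5 * n - 2)) * (1 - q ^ (5 * n - 3)))) = exp (- suminf (rr_term q))"
    using rS by (simp add: sums_iff)
qed

text \<open>The exponential form yields both the logarithm of the norm and the absence of zeros in
  the upper half-plane.\<close>

lemma rr_cf_conv_exp:
  assumes "Im \<tau> > 0"
  shows "rr_cf \<tau> = exp (2 * of_real pi * \<i> * \<tau> / 5 - suminf (rr_term (exp (2 * of_real pi * \<i> * \<tau>))))"
proof -
  have "norm (exp (2 * of_real pi * \<i> * \<tau>)) < 1" using assms by simp
  from rr_product_conv_exp(2)[OF this] show ?thesis
    unfolding rr_cf_def Let_def diff_conv_add_uminus exp_add by (simp only:)
qed

lemma ln_norm_rr_cf: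
  assumes "Im \<tau> > 0"
  shows "ln (norm (rr_cf \<tau>)) = - 2 * pi * Im \<tau> / 5 - Re (suminf (rr_term (exp (2 * of_real pi * \<i> * \<tau>))))"
  unfolding rr_cf_conv_exp[OF assms] by simp

section \<open>The Gauss sum modulo 5\<close>

text \<open>This is \<open>(k/5) sqrt 5\<close>, with the Legendre symbol \<open>(k/5)\<close>.\<close>

definition gauss5 :: "int \<Rightarrow> real" where
  "gauss5 k = 2 * cos (2 * pi * k / 5) - 2 * cos (4 * pi * k / 5)"

lemma gauss5_add_multiple: "gauss5 (k + 5 * j) = gauss5 k"
proof -
  have "2 * pi * (k + 5 * j) / 5 = 2 * pi * k / 5 + of_int j * (2 * of_real pi)"
       "4 * pi * (k + 5 * j) / 5 = 4 * pi * k / 5 + of_int (2 * j) * (2 * of_real pi)"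
    by (simp_all add: field_simps)
  thus ?thesis unfolding gauss5_def by (simp only: cos.plus_of_int)
qed

lemma gauss5_minus: "gauss5 (- k) = gauss5 k"
  by (simp add: gauss5_def)

text \<open>2 is a nonresidue modulo 5: doubling the angles sends \<open>2 \<pi> k / 5\<close> to
  \<open>4 \<pi> k / 5\<close> and the latter to \<open>- 2 \<pi> k / 5\<close> up to full turns, so
  the two cosines trade places.\<close>

lemma gauss5_double: "gauss5 (2 * k) = - gauss5 k"
proof -
  have "4 * pi * (2 * k) / 5 = - (2 * pi * k / 5) + of_int k * (2 * of_real pi)"
    by (simp add: field_simps)
  hence "cos (4 * pi * (2 * k) / 5) = cos (2 * pi * k / 5)"
    by (simp only: cos.plus_of_int cos_minus)
  thus ?thesis by (simp add: gauss5_def mult_ac)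
qed

text \<open>For \<open>b\<close> prime to 5 the only such \<open>e\<close> is the Legendre symbol of
  \<open>b\<close> modulo 5. Encoded as a functional equation, its multiplicativity is
  immediate.\<close>

definition twists_gauss5 :: "int \<Rightarrow> real \<Rightarrow> bool" where
  "twists_gauss5 b e \<longleftrightarrow> (\<forall>k. gauss5 (b * k) = e * gauss5 k)"

lemma twists_gauss5_1: "twists_gauss5 1 1"
  and twists_gauss5_2: "twists_gauss5 2 (- 1)"
  by (simp_all add: twists_gauss5_def gauss5_double)

lemma twists_gauss5_mult:
  "twists_gauss5 b e \<Longrightarrow> twists_gauss5 b' e' \<Longrightarrow> twists_gauss5 (b * b') (e * e')"
  by (simp add: twists_gauss5_def mult.assoc)

lemma twists_gauss5_uminus: "twists_gauss5 b e \<Longrightarrow> twists_gauss5 (- b) e"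
  by (simp add: twists_gauss5_def gauss5_minus)

lemma twists_gauss5_cong:
  assumes "twists_gauss5 b e" "[b' = b] (mod 5)"
  shows "twists_gauss5 b' e"
proof -
  obtain j where "b' = b + 5 * j" using assms(2)[THEN cong_sym] by (auto simp: cong_iff_lin)
  hence "b' * k = b * k + 5 * (j * k)" for k by (simp add: algebra_simps)
  thus ?thesis using assms(1) by (simp add: twists_gauss5_def gauss5_add_multiple)
qed

lemma gauss5_1_pos: "gauss5 1 > 0"
proof -
  have "cos (4 * pi / 5) < cos (2 * pi / 5)"
    by (rule cos_monotone_0_pi) (use pi_gt_zero in auto)
  thus ?thesis by (simp add: gauss5_def)
qed

lemma abs_gauss5_le: "\<bar>gauss5 k\<bar> \<le> gauss5 1"
proof -
  have c: "gauss5 k = gauss5 r" if "[k = r] (mod 5)" for r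
    using that[THEN cong_sym] by (auto simp: cong_iff_lin gauss5_add_multiple)
  have "k mod 5 \<in> {0..<5}" by simp
  moreover have "{0..<5::int} = {0, 1, 2, 3, 4}" by auto
  \<comment> \<open>Residues 2, 3, 4 are written as \<open>2 * 1\<close>, \<open>- (2 * 1)\<close>,
    \<open>-1\<close> so that the rules for doubling and negation reduce them to
    \<open>gauss5 1\<close>.\<close>
  ultimately have "[k = 0] (mod 5) \<or> [k = 1] (mod 5) \<or> [k = 2 * 1] (mod 5) \<or> [k = - (2 * 1)] (mod 5) \<or> [k = -1] (mod 5)"
    by (auto simp: cong_def)
  hence "gauss5 k \<in> {gauss5 0, gauss5 1, - gauss5 1}"
    using c[of 0] c[of 1] c[of "2 * 1"] c[of "- (2 * 1)"] c[of "-1"]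
    unfolding gauss5_minus gauss5_double by blast
  moreover have "gauss5 0 = 0" by (simp add: gauss5_def)
  ultimately show ?thesis using gauss5_1_pos by auto
qed

text \<open>This is \<open>sqrt 5 / (10 \<pi>) * L(2, \<chi>)\<close> for the quadratic character
  \<open>\<chi>\<close> modulo 5.\<close>

definition rr_growth :: real where
  "rr_growth = (\<Sum>m. gauss5 (int (Suc m)) / (10 * pi * real (Suc m) ^ 2))"

text \<open>Comparison with the inverse squares. For positivity, the first term outweighs the bound
  on all the others, since \<open>\<pi>^2 / 6 - 1 < 1\<close>.\<close>

lemma rr_growth_summable: "summable (\<lambda>m. gauss5 (int (Suc m)) / (10 * pi * real (Suc m) ^ 2))"
  and rr_growth_pos: "rr_growth > 0"
proof -
  let ?c = "gauss5 1 / (10 * pi)"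
  define f where "f m = gauss5 (int (Suc m)) / (10 * pi * real (Suc m) ^ 2)" for m
  define g where "g m = ?c * (1 / real (Suc m) ^ 2)" for m
  have g: "g sums (?c * (pi ^ 2 / 6))"
    unfolding g_def by (intro sums_mult) (use inverse_squares_sums in simp)
  have fg: "norm (f m) \<le> g m" for m
    using abs_gauss5_le[of "int (Suc m)"]
    by (simp add: f_def g_def abs_mult divide_simps del: of_nat_Suc)
  have sf: "summable f"
    by (rule summable_comparison_test'[OF sums_summable[OF g]]) (use fg in auto)
  thus "summable (\<lambda>m. gauss5 (int (Suc m)) / (10 * pi * real (Suc m) ^ 2))"
    by (simp add: f_def[abs_def])
  have sg: "summable (\<lambda>m. g (Suc m))" using g by (auto simp: summable_Suc_iff sums_iff)
  have "norm (\<Sum>m. f (Suc m)) \<le> (\<Sum>m. g (Suc m))"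
    by (rule norm_suminf_le[OF fg sg])
  also have "(\<Sum>m. g (Suc m)) = ?c * (pi ^ 2 / 6) - ?c"
    using suminf_split_head[of g] g by (simp add: sums_iff g_def)
  also have "\<dots> < ?c"
  proof -
    have "pi ^ 2 < 3.2 ^ 2" using pi_approx pi_gt_zero by (intro power_strict_mono) auto
    hence "?c * (pi ^ 2 / 6) < ?c * 2"
      using gauss5_1_pos by (intro mult_strict_left_mono) (auto simp: power2_eq_square)
    thus ?thesis by simp
  qed
  finally have "- ?c < (\<Sum>m. f (Suc m))" by simp
  moreover have "suminf f = ?c + (\<Sum>m. f (Suc m))"
    using suminf_split_head[OF sf] by (simp add: f_def)
  ultimately show "rr_growth > 0" by (simp add: rr_growth_def f_def[abs_def])
qed

section \<open>Growth at the cusps\<close>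

text \<open>Conjugation inverts \<open>u\<close>, so \<open>u ^ 4\<close> and \<open>u ^ 3\<close>
  are the conjugates of \<open>u\<close> and \<open>u ^ 2\<close>, and the sum collapses to real
  cosines.\<close>

lemma fifth_root_of_unity_gauss5:
  fixes k :: int
  defines "u \<equiv> exp (2 * of_real pi * \<i> * of_int k / 5)"
  shows "u ^ 5 = 1" "u - u ^ 2 - u ^ 3 + u ^ 4 = of_real (gauss5 k)"
proof -
  have u: "u = cis (2 * pi * k / 5)"
    unfolding u_def cis_conv_exp by (simp add: field_simps)
  show u5: "u ^ 5 = 1"
    unfolding u Complex.DeMoivre using cis_multiple_2pi[of "of_int k"] by (simp add: mult_ac)
  have nu: "u * cnj u = 1" "u \<noteq> 0" by (simp_all add: u cis_cnj cis_mult)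
  have "u * u ^ 4 = u * cnj u" using u5 nu by (simp add: eval_nat_numeral)
  hence u4: "u ^ 4 = cnj u" using nu(2) by (simp only: mult_cancel_left) auto
  have "u ^ 2 * u ^ 3 = u ^ 2 * (cnj u) ^ 2"
    using u5 nu(1) by (simp add: power_mult_distrib[symmetric] flip: power_add)
  hence u3: "u ^ 3 = cnj (u ^ 2)" using nu(2) by (simp only: mult_cancel_left) auto
  have "u ^ 2 = cis (4 * pi * k / 5)" unfolding u by (simp add: Complex.DeMoivre mult_ac)
  have "u - u ^ 2 - u ^ 3 + u ^ 4 = (u + cnj u) - (u ^ 2 + cnj (u ^ 2))"
    unfolding u3 u4 by simp
  also have "\<dots> = of_real (2 * Re u - 2 * Re (u ^ 2))"
    by (simp only: complex_add_cnj of_real_diff)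
  also have "2 * Re u - 2 * Re (u ^ 2) = gauss5 k"
    unfolding \<open>u ^ 2 = _\<close> unfolding u gauss5_def by simp
  finally show "u - u ^ 2 - u ^ 3 + u ^ 4 = of_real (gauss5 k)" .
qed

text \<open>The power \<open>q ^ Suc m\<close> tends to a root of unity \<open>u\<close>. If
  \<open>d\<close> divides \<open>Suc m\<close>, then \<open>u ^ 5 = 1\<close> and the factor
  \<open>y\<close> cancels the simple zero of \<open>1 - w ^ 5\<close>; otherwise the quotient stays
  bounded and the factor \<open>y\<close> kills it.\<close>

lemma rr_term_limit:
  fixes b :: int and d :: nat
  assumes d: "d > 0" "coprime b (int d)"
  shows "((\<lambda>y. of_real y * rr_term (exp (2 * of_real pi * \<i> * (of_real (b / (5 * real d)) + \<i> * of_real y))) m)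
     \<longlongrightarrow> of_real (if d dvd Suc m then gauss5 (b * int (Suc m div d)) / (10 * pi * real (Suc m) ^ 2) else 0))
     (at_right 0)"
proof -
  define M where "M = Suc m"
  have M: "M > 0" by (simp add: M_def)
  define u :: complex where "u = exp (2 * of_real pi * \<i> * of_real (b * M / (5 * real d)))"
  define w :: "real \<Rightarrow> complex" where "w y = u * of_real (exp (- 2 * pi * y * M))" for y
  have w: "exp (2 * of_real pi * \<i> * (of_real (b / (5 * real d)) + \<i> * of_real y)) ^ M = w y" for y
    unfolding w_def u_def exp_of_nat_mult[symmetric] exp_of_real[symmetric] exp_add[symmetric]
    by (rule arg_cong[of _ _ exp]) (simp add: algebra_simps)
  have lim_w: "(w \<longlongrightarrow> u) (at_right 0)"
    unfolding w_def by (auto intro!: tendsto_eq_intros)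
  have "((\<lambda>y. of_real y * ((w y - w y ^ 2 - w y ^ 3 + w y ^ 4) / (1 - w y ^ 5) / of_nat M))
     \<longlongrightarrow> of_real (if d dvd M then gauss5 (b * int (M div d)) / (10 * pi * real M ^ 2) else 0))
     (at_right 0)"
  proof (cases "d dvd M")
    case True
    then obtain n where n: "M = d * n" by (auto simp: dvd_def)
    have u: "u = exp (2 * of_real pi * \<i> * of_int (b * int n) / 5)"
      unfolding u_def using d n by (simp add: field_simps)
    have u5: "u ^ 5 = 1" and ug: "u - u ^ 2 - u ^ 3 + u ^ 4 = of_real (gauss5 (b * int n))"
      unfolding u by (rule fifth_root_of_unity_gauss5)+
    have w5: "w y ^ 5 = of_real (exp (- 10 * pi * y * M))" for y
      unfolding w_def power_mult_distrib u5 of_real_power[symmetric] exp_of_nat_mult[symmetric] by simp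
    \<comment> \<open>\<open>1 - exp (- 10 \<pi> y M)\<close> is asymptotic to
      \<open>10 \<pi> M y\<close>; the division by \<open>M\<close> inside the term supplies the
      second \<open>M\<close> of the limit.\<close>
    have lim: "((\<lambda>y. y / (1 - exp (- 10 * pi * y * M))) \<longlongrightarrow> 1 / (10 * pi * M)) (at_right 0)"
      using M by (real_asymp simp: field_simps)
    have "((\<lambda>y. (w y - w y ^ 2 - w y ^ 3 + w y ^ 4) * of_real (y / (1 - exp (- 10 * pi * y * M))) / of_nat M)
        \<longlongrightarrow> (u - u ^ 2 - u ^ 3 + u ^ 4) * of_real (1 / (10 * pi * M)) / of_nat M) (at_right 0)"
      using M by (intro tendsto_divide tendsto_mult tendsto_of_real[OF lim] tendsto_intros lim_w) auto
    also have "(u - u ^ 2 - u ^ 3 + u ^ 4) * of_real (1 / (10 * pi * M)) / of_nat M =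
       of_real (gauss5 (b * int (M div d)) / (10 * pi * real M ^ 2))"
      unfolding ug using n d by (simp add: power2_eq_square)
    also have "(\<lambda>y. (w y - w y ^ 2 - w y ^ 3 + w y ^ 4) * of_real (y / (1 - exp (- 10 * pi * y * M))) / of_nat M)
        = (\<lambda>y. of_real y * ((w y - w y ^ 2 - w y ^ 3 + w y ^ 4) / (1 - w y ^ 5) / of_nat M))"
      unfolding w5 by (simp add: fun_eq_iff)
    finally show ?thesis using True by simp
  next
    case False
    \<comment> \<open>Otherwise \<open>b * M / d\<close> would be an integer, and coprimality would
      give \<open>d dvd M\<close>.\<close>
    have "u ^ 5 \<noteq> 1"
    proof
      assume "u ^ 5 = 1"
      hence "exp (2 * of_real pi * \<i> * of_real (b * M / real d)) = 1"
        unfolding u_def exp_of_nat_mult[symmetric] by (simp add: field_simps)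
      then obtain n :: int where "2 * pi * (b * M / real d) = of_int (2 * n) * pi"
        by (auto simp: exp_eq_1)
      hence "of_int (b * int M) = (of_int (n * int d) :: real)" using d by (simp add: field_simps)
      hence "b * int M = n * int d" by (simp only: of_int_eq_iff)
      hence "int d dvd b * int M" by simp
      hence "int d dvd int M" using d(2) by (simp add: coprime_dvd_mult_right_iff coprime_commute)
      thus False using False by simp
    qed
    hence "((\<lambda>y. of_real y * ((w y - w y ^ 2 - w y ^ 3 + w y ^ 4) / (1 - w y ^ 5) / of_nat M))
        \<longlongrightarrow> of_real 0 * ((u - u ^ 2 - u ^ 3 + u ^ 4) / (1 - u ^ 5) / of_nat M)) (at_right 0)"
      using M by (intro tendsto_intros lim_w) auto
    thus ?thesis using False by simp
  qed
  thus ?thesis unfolding rr_term_def Let_def w M_def[symmetric] .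
qed

text \<open>A bound uniform in \<open>y\<close>, for use in Tannery's theorem:
  \<open>exp t - 1 \<ge> t\<close> with \<open>t\<close> proportional to \<open>y\<close> absorbs
  the factor \<open>y\<close>.\<close>

lemma norm_rr_term_scaled_le:
  assumes "y > 0"
  shows "norm (of_real y * rr_term (exp (2 * of_real pi * \<i> * (of_real x + \<i> * of_real y))) m)
           \<le> 1 / (2 * pi) * (1 / real (Suc m) ^ 2)"
proof -
  let ?q = "exp (2 * of_real pi * \<i> * (of_real x + \<i> * of_real y))"
  define t where "t = 2 * pi * y * real (Suc m)"
  have t: "t > 0" using assms by (simp add: t_def)
  have nq: "norm ?q = exp (- (2 * pi * y))" by simp
  have "norm ?q < 1" unfolding nq using assms by simp
  from norm_rr_term_le[OF this, of m]
  have "norm (of_real y * rr_term ?q m) \<le> y * (norm ?q ^ Suc m / (1 - norm ?q ^ Suc m) / real (Suc m))"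
    unfolding norm_mult using assms by (intro mult_mono) auto
  also have "norm ?q ^ Suc m = exp (- t)"
    unfolding nq t_def exp_of_nat_mult[symmetric] by (simp add: algebra_simps)
  also have "exp (- t) / (1 - exp (- t)) = 1 / (exp t - 1)"
    using t by (simp add: exp_minus field_simps)
  also have "1 + t \<le> exp t" by simp
  hence "1 / (exp t - 1) \<le> 1 / t" using t by (intro divide_left_mono mult_pos_pos) linarith+
  hence "y * (1 / (exp t - 1) / real (Suc m)) \<le> y * (1 / t / real (Suc m))"
    using assms by (intro mult_left_mono divide_right_mono) auto
  also have "\<dots> = 1 / (2 * pi) * (1 / real (Suc m) ^ 2)"
    using assms by (simp add: t_def power2_eq_square divide_simps del: of_nat_Suc)
  finally show ?thesis by simp
qed

text \<open>The termwise limits vanish unless \<open>d\<close> divides \<open>Suc m\<close>. Writing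
  \<open>Suc m = d * Suc n\<close> pulls out \<open>1 / d^2\<close> and, from the twist by
  \<open>b\<close>, the factor \<open>e\<close>; the series of \<open>rr_growth\<close>
  remains.\<close>

lemma rr_cf_cusp_growth:
  fixes b :: int and d :: nat
  assumes d: "d > 0" "coprime b (int d)" and e: "twists_gauss5 b e"
  shows "((\<lambda>y. y * ln (norm (rr_cf (of_real (b / (5 * real d)) + \<i> * of_real y))))
           \<longlongrightarrow> - (e * rr_growth / real d ^ 2)) (at_right 0)"
proof -
  define q where "q y = exp (2 * of_real pi * \<i> * (of_real (b / (5 * real d)) + \<i> * of_real y))" for y :: real
  define l where "l m = (if d dvd Suc m then gauss5 (b * int (Suc m div d)) / (10 * pi * real (Suc m) ^ 2) else 0)" for m
  have ev: "eventually (\<lambda>(k, y). norm (of_real y * rr_term (q y) k) \<le> 1 / (2 * pi) * (1 / real (Suc k) ^ 2))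
     (at_top \<times>\<^sub>F at_right 0)"
    unfolding eventually_prod_filter q_def case_prod_conv
  proof (intro exI conjI allI impI)
    show "eventually (\<lambda>_::nat. True) at_top" "eventually (\<lambda>y::real. y > 0) (at_right 0)"
      by (simp_all add: eventually_at_right_less)
  qed (rule norm_rr_term_scaled_le)
  have sq: "summable (\<lambda>k. 1 / (2 * pi) * (1 / real (Suc k) ^ 2))"
    using sums_summable[OF inverse_squares_sums] by (intro summable_mult) simp
  have "((\<lambda>y. \<Sum>m. of_real y * rr_term (q y) m) \<longlongrightarrow> (\<Sum>m. of_real (l m))) (at_right 0)"
    using tannerys_theorem[OF _ ev sq, of "\<lambda>m. of_real (l m)"] rr_term_limit[OF d]
    by (simp add: q_def l_def)
  moreover have l_sums: "l sums (e * rr_growth / real d ^ 2)"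
  proof -
    \<comment> \<open>These are the surviving indices: with the shift, \<open>Suc (h n)\<close> runs
      through the positive multiples of \<open>d\<close>.\<close>
    define h where "h n = d * Suc n - 1" for n
    have h: "Suc (h n) = d * Suc n" for n using d by (simp add: h_def)
    have mono: "strict_mono h" unfolding strict_mono_Suc_iff
      using d h by (metis Suc_less_eq lessI mult_less_cancel1)
    have zero: "l m = 0" if "m \<notin> range h" for m
    proof -
      have "\<not> d dvd Suc m"
      proof
        assume "d dvd Suc m"
        then obtain k where k: "Suc m = d * k" by (auto simp: dvd_def)
        then obtain n where "k = Suc n" by (cases k) auto
        hence "m = h n" using k h by (metis Suc_inject)
        thus False using that by auto
      qed
      thus ?thesis by (simp add: l_def)
    qed
    have lh: "l (h n) = e / real d ^ 2 * (gauss5 (int (Suc n)) / (10 * pi * real (Suc n) ^ 2))" for n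
      using d e unfolding l_def h twists_gauss5_def
      by (simp add: power_mult_distrib del: of_nat_Suc mult_Suc_right)
    have "(\<lambda>n. l (h n)) sums (e / real d ^ 2 * rr_growth)"
      unfolding lh rr_growth_def by (intro sums_mult summable_sums rr_growth_summable)
    thus ?thesis using sums_mono_reindex[OF mono, of l] zero by simp
  qed
  ultimately have "((\<lambda>y. \<Sum>m. of_real y * rr_term (q y) m) \<longlongrightarrow> of_real (e * rr_growth / real d ^ 2)) (at_right 0)"
    using sums_unique[OF sums_of_real[OF l_sums, where 'a = complex]] by simp
  \<comment> \<open>The prefactor \<open>q^(1/5)\<close> contributes only
    \<open>- 2 \<pi> y^2 / 5\<close>, which tends to 0.\<close>
  hence "((\<lambda>y. y * (- 2 * pi * y / 5) - Re (\<Sum>m. of_real y * rr_term (q y) m)) \<longlongrightarrow>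
           0 * (- 2 * pi * 0 / 5) - Re (of_real (e * rr_growth / real d ^ 2))) (at_right 0)"
    by (intro tendsto_intros) auto
  moreover have "eventually (\<lambda>y. y * (- 2 * pi * y / 5) - Re (\<Sum>m. of_real y * rr_term (q y) m) =
      y * ln (norm (rr_cf (of_real (b / (5 * real d)) + \<i> * of_real y)))) (at_right 0)"
    using eventually_at_right_less[of 0]
  proof eventually_elim
    case (elim y)
    have nq: "norm (q y) < 1" using elim by (simp add: q_def)
    have "(\<Sum>m. of_real y * rr_term (q y) m) = of_real y * suminf (rr_term (q y))"
      by (rule suminf_mult[OF rr_product_conv_exp(1)[OF nq]])
    moreover define \<tau> where "\<tau> = of_real (b / (5 * real d)) + \<i> * of_real y"
    have "Im \<tau> = y" by (simp add: \<tau>_def)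
    hence "ln (norm (rr_cf \<tau>)) = - 2 * pi * y / 5 - Re (suminf (rr_term (q y)))"
      using ln_norm_rr_cf[of \<tau>] elim unfolding q_def \<tau>_def[symmetric] by simp
    ultimately show ?case unfolding \<tau>_def[symmetric] by (simp add: right_diff_distrib)
  qed
  ultimately show ?thesis by (auto dest: Lim_transform_eventually)
qed

section \<open>Passing from r to the quotient l\<close>

text \<open>The point \<open>2 \<tau>\<close> approaches the cusp with numerator
  \<open>2 * b\<close>, whose symbol has the opposite sign. Both parts of
  \<open>ln |r(2 \<tau>)| - 2 ln |r(\<tau>)|\<close> therefore push the same way, with weights 1/2
  and 2 adding up to 5/2. The speed \<open>c\<close> serves for \<open>p \<tau>\<close>, which moves
  \<open>p\<close> times as fast.\<close>

lemma rr_l_cusp_growth: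
  fixes b :: int and d :: nat
  assumes d: "d > 0" "coprime (2 * b) (int d)" and e: "twists_gauss5 b e" and c: "c > 0"
  shows "((\<lambda>y. y * ln (norm (rr_l (of_real (b / (5 * real d)) + \<i> * of_real (c * y)))))
           \<longlongrightarrow> 5 / 2 * rr_growth * e / (real d ^ 2 * c)) (at_right 0)"
proof -
  define x where "x = b / (5 * real d)"
  have scale: "filterlim (\<lambda>y. a * y) (at_right 0) (at_right (0::real))" if "a > 0" for a
    using that by real_asymp
  have cop: "coprime b (int d)" using d(2) by simp
  have A: "((\<lambda>y. y * ln (norm (rr_cf (of_real x + \<i> * of_real y)))) \<longlongrightarrow> - (e * rr_growth / real d ^ 2)) (at_right 0)"
    unfolding x_def by (rule rr_cf_cusp_growth[OF d(1) cop e])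
  have "twists_gauss5 (2 * b) (- e)" using twists_gauss5_mult[OF twists_gauss5_2 e] by simp
  from rr_cf_cusp_growth[OF d this]
  have B: "((\<lambda>y. y * ln (norm (rr_cf (of_real (2 * x) + \<i> * of_real y)))) \<longlongrightarrow> e * rr_growth / real d ^ 2) (at_right 0)"
    by (simp add: x_def)
  \<comment> \<open>The heights are \<open>c * y\<close> for \<open>\<tau>\<close> and
    \<open>2 * c * y\<close> for \<open>2 \<tau>\<close>, hence the divisors \<open>c\<close> and
    \<open>2 * c\<close>.\<close>
  have "((\<lambda>y. (2 * c * y * ln (norm (rr_cf (of_real (2 * x) + \<i> * of_real (2 * c * y))))) / (2 * c) -
              2 * (c * y * ln (norm (rr_cf (of_real x + \<i> * of_real (c * y))))) / c) \<longlongrightarrow>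
           e * rr_growth / real d ^ 2 / (2 * c) - 2 * (- (e * rr_growth / real d ^ 2)) / c) (at_right 0)"
    by (intro tendsto_intros filterlim_compose[OF A scale] filterlim_compose[OF B scale]) (use c in auto)
  also have "e * rr_growth / real d ^ 2 / (2 * c) - 2 * (- (e * rr_growth / real d ^ 2)) / c
      = 5 / 2 * rr_growth * e / (real d ^ 2 * c)"
    using c d by (simp add: field_simps)
  finally have L: "((\<lambda>y. (2 * c * y * ln (norm (rr_cf (of_real (2 * x) + \<i> * of_real (2 * c * y))))) / (2 * c) -
              2 * (c * y * ln (norm (rr_cf (of_real x + \<i> * of_real (c * y))))) / c) \<longlongrightarrow>
           5 / 2 * rr_growth * e / (real d ^ 2 * c)) (at_right 0)" .
  have "eventually (\<lambda>y. (2 * c * y * ln (norm (rr_cf (of_real (2 * x) + \<i> * of_real (2 * c * y))))) / (2 * c) -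
              2 * (c * y * ln (norm (rr_cf (of_real x + \<i> * of_real (c * y))))) / c =
          y * ln (norm (rr_l (of_real x + \<i> * of_real (c * y))))) (at_right 0)"
    using eventually_at_right_less[of 0]
  proof eventually_elim
    case (elim y)
    define \<tau> where "\<tau> = of_real x + \<i> * of_real (c * y)"
    have \<tau>: "Im \<tau> > 0" "Im (2 * \<tau>) > 0" using elim c by (simp_all add: \<tau>_def)
    have two: "2 * \<tau> = of_real (2 * x) + \<i> * of_real (2 * c * y)"
      by (simp add: \<tau>_def algebra_simps)
    have nz: "norm (rr_cf \<tau>) > 0" "norm (rr_cf (2 * \<tau>)) > 0"
      using rr_cf_conv_exp[OF \<tau>(1)] rr_cf_conv_exp[OF \<tau>(2)] by simp_all
    have "ln (norm (rr_l \<tau>)) = ln (norm (rr_cf (2 * \<tau>))) - 2 * ln (norm (rr_cf \<tau>))"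
      unfolding rr_l_def norm_divide norm_power using nz by (simp add: ln_div ln_realpow)
    thus ?case using c unfolding two[symmetric] \<tau>_def[symmetric] by (simp add: right_diff_distrib)
  qed
  from Lim_transform_eventually[OF L this] show ?thesis unfolding x_def .
qed

lemma rr_l_nonzero: "Im \<tau> > 0 \<Longrightarrow> rr_l \<tau> \<noteq> 0"
  by (simp add: rr_l_def rr_cf_conv_exp)

section \<open>Newton polygons\<close>

lemma poly_conv_sum_atMost:
  fixes p :: "'a :: comm_semiring_1 poly"
  assumes "degree p \<le> n"
  shows "poly p x = (\<Sum>i\<le>n. coeff p i * x ^ i)"
  unfolding poly_altdef using assms by (intro sum.mono_neutral_left) (auto simp: coeff_eq_0)

lemma eval2_conv_sum:
  assumes "degree L \<le> n" "\<And>j. degree (coeff L j) \<le> n"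
  shows "eval2 L x y = (\<Sum>(i, j) \<in> {..n} \<times> {..n}. of_rat (coeff2 L i j) * x ^ i * y ^ j)"
proof -
  have inner: "poly (map_poly of_rat (coeff L j)) x = (\<Sum>i\<le>n. of_rat (coeff2 L i j) * x ^ i)" for j
    using assms(2)[of j]
    by (subst poly_conv_sum_atMost, rule order_trans[OF map_poly_degree_leq]) (simp_all add: coeff_map_poly coeff2_def)
  have "eval2 L x y = (\<Sum>j\<le>n. poly (map_poly of_rat (coeff L j)) x * y ^ j)"
    unfolding eval2_def using assms(1)
    by (subst poly_conv_sum_atMost, rule order_trans[OF map_poly_degree_leq]) (simp_all add: coeff_map_poly)
  also have "\<dots> = (\<Sum>j\<le>n. \<Sum>i\<le>n. of_rat (coeff2 L i j) * x ^ i * y ^ j)"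
    unfolding inner sum_distrib_right ..
  also have "\<dots> = (\<Sum>(i, j) \<in> {..n} \<times> {..n}. of_rat (coeff2 L i j) * x ^ i * y ^ j)"
    by (subst sum.swap) (rule sum.cartesian_product)
  finally show ?thesis .
qed

section \<open>Dominant monomials along a curve\<close>

text \<open>Half the limiting rate is an eventual bound, and \<open>exp (c / 2 / y)\<close> tends to
  0 because \<open>c < 0\<close>.\<close>

lemma tendsto_zero_of_scaled_ln_norm:
  fixes f :: "real \<Rightarrow> complex"
  assumes "((\<lambda>y. y * ln (norm (f y))) \<longlongrightarrow> c) (at_right 0)" "c < 0"
    and "eventually (\<lambda>y. f y \<noteq> 0) (at_right 0)"
  shows "(f \<longlongrightarrow> 0) (at_right 0)"
proof (rule Lim_null_comparison)
  show "((\<lambda>y. exp (c / 2 / y)) \<longlongrightarrow> 0) (at_right 0)"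
    using assms(2) by real_asymp
  have "eventually (\<lambda>y. y * ln (norm (f y)) < c / 2) (at_right 0)"
    using assms(1,2) by (intro order_tendstoD(2)) auto
  with assms(3) eventually_at_right_less[of 0]
  show "eventually (\<lambda>y. norm (f y) \<le> exp (c / 2 / y)) (at_right 0)"
  proof eventually_elim
    case (elim y)
    hence "ln (norm (f y)) \<le> c / 2 / y" by (simp add: field_simps)
    thus ?case using elim by (metis exp_le_cancel_iff exp_ln zero_less_norm_iff)
  qed
qed

text \<open>If the leading monomial along a curve were unique, the equation could not hold near its end.\<close>

lemma top_weight_not_unique:
  fixes a :: "nat \<Rightarrow> nat \<Rightarrow> complex" and X Y :: "real \<Rightarrow> complex"
  assumes fin: "finite A" and mem: "(i0, j0) \<in> A" "a i0 j0 \<noteq> 0"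
    and X: "((\<lambda>y. y * ln (norm (X y))) \<longlongrightarrow> \<alpha>) (at_right 0)"
    and Y: "((\<lambda>y. y * ln (norm (Y y))) \<longlongrightarrow> \<beta>) (at_right 0)"
    and nz: "\<And>y. y > 0 \<Longrightarrow> X y \<noteq> 0 \<and> Y y \<noteq> 0"
    and eq: "\<And>y. y > 0 \<Longrightarrow> (\<Sum>(i, j) \<in> A. a i j * X y ^ i * Y y ^ j) = 0"
  shows "\<exists>(i, j) \<in> A. a i j \<noteq> 0 \<and> (i, j) \<noteq> (i0, j0) \<and> \<alpha> * i + \<beta> * j \<ge> \<alpha> * i0 + \<beta> * j0"
proof (rule ccontr)
  assume neg: "\<not> ?thesis"
  \<comment> \<open>Monomials relative to the supposed leader. The scaled logarithm of
    \<open>T p\<close> tends to a difference of weights, which is negative for every other monomial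
    with nonzero coefficient.\<close>
  define T where "T = (\<lambda>(i, j) y. X y ^ i * Y y ^ j / (X y ^ i0 * Y y ^ j0))"
  have T0: "((\<lambda>y. (case p of (i, j) \<Rightarrow> a i j) * T p y) \<longlongrightarrow> 0) (at_right 0)" if p: "p \<in> A - {(i0, j0)}" for p
  proof -
    obtain i j where ij: "p = (i, j)" by force
    show ?thesis
    proof (cases "a i j = 0")
      case False
      hence lt: "\<alpha> * i + \<beta> * j - (\<alpha> * i0 + \<beta> * j0) < 0" using neg p ij by auto
      have "((\<lambda>y. y * ln (norm (X y)) * i + y * ln (norm (Y y)) * j - (y * ln (norm (X y)) * i0 + y * ln (norm (Y y)) * j0))
         \<longlongrightarrow> \<alpha> * i + \<beta> * j - (\<alpha> * i0 + \<beta> * j0)) (at_right 0)"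
        by (intro tendsto_intros X Y)
      moreover have "eventually (\<lambda>y. y * ln (norm (X y)) * i + y * ln (norm (Y y)) * j - (y * ln (norm (X y)) * i0 + y * ln (norm (Y y)) * j0)
          = y * ln (norm (T p y))) (at_right 0)"
        using eventually_at_right_less[of 0]
      proof eventually_elim
        case (elim y)
        hence "norm (X y) > 0" "norm (Y y) > 0" using nz by auto
        thus ?case unfolding ij T_def
          by (simp add: norm_mult norm_divide norm_power ln_div ln_mult ln_realpow algebra_simps)
      qed
      ultimately have "((\<lambda>y. y * ln (norm (T p y))) \<longlongrightarrow> \<alpha> * i + \<beta> * j - (\<alpha> * i0 + \<beta> * j0)) (at_right 0)"
        by (rule Lim_transform_eventually)
      moreover have "eventually (\<lambda>y. T p y \<noteq> 0) (at_right 0)"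
        using eventually_at_right_less[of 0] by eventually_elim (use nz in \<open>auto simp: T_def ij\<close>)
      ultimately have "(T p \<longlongrightarrow> 0) (at_right 0)" using lt tendsto_zero_of_scaled_ln_norm by blast
      thus ?thesis by (rule tendsto_mult_right_zero)
    qed (simp add: ij)
  qed
  have "((\<lambda>y. a i0 j0 + (\<Sum>p \<in> A - {(i0, j0)}. (case p of (i, j) \<Rightarrow> a i j) * T p y)) \<longlongrightarrow> a i0 j0 + (\<Sum>p \<in> A - {(i0, j0)}. 0)) (at_right 0)"
    by (intro tendsto_add tendsto_const tendsto_sum T0)
  moreover have "eventually (\<lambda>y. a i0 j0 + (\<Sum>p \<in> A - {(i0, j0)}. (case p of (i, j) \<Rightarrow> a i j) * T p y) = 0) (at_right 0)"
    using eventually_at_right_less[of 0]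
  proof eventually_elim
    case (elim y)
    have "T (i0, j0) y = 1" using nz[OF elim] by (simp add: T_def)
    hence "a i0 j0 + (\<Sum>p \<in> A - {(i0, j0)}. (case p of (i, j) \<Rightarrow> a i j) * T p y) =
           (\<Sum>p \<in> A. (case p of (i, j) \<Rightarrow> a i j) * T p y)"
      using sum.remove[OF fin mem(1), of "\<lambda>p. (case p of (i, j) \<Rightarrow> a i j) * T p y"] by simp
    also have "\<dots> = (\<Sum>(i, j) \<in> A. a i j * X y ^ i * Y y ^ j) / (X y ^ i0 * Y y ^ j0)"
      unfolding sum_divide_distrib by (intro sum.cong) (auto simp: T_def)
    also have "\<dots> = 0" using eq[OF elim] by simp
    finally show ?case .
  qed
  ultimately have "((\<lambda>_. 0) \<longlongrightarrow> a i0 j0) (at_right (0::real))"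
    by (auto dest: Lim_transform_eventually)
  hence "a i0 j0 = 0" by (simp add: tendsto_const_iff)
  with mem(2) show False by simp
qed

section \<open>Edges of lattice point sets in a box\<close>

text \<open>For finite \<open>S\<close> and \<open>(u, v) \<noteq> (0, 0)\<close>: the convex hull
  of \<open>S\<close> has an edge with outer normal \<open>(u, v)\<close>.\<close>

definition has_face :: "(int \<times> int) set \<Rightarrow> int \<Rightarrow> int \<Rightarrow> bool" where
  "has_face S u v \<longleftrightarrow> (\<exists>(i, j) \<in> S. \<exists>(i', j') \<in> S. (i, j) \<noteq> (i', j') \<and>
     u * i + v * j = u * i' + v * j' \<and> (\<forall>(k, l) \<in> S. u * k + v * l \<le> u * i + v * j))"

text \<open>At a maximiser, \<open>two\<close> yields another point whose weight cannot be larger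
  and hence is equal.\<close>

lemma has_faceI:
  assumes "finite S" "S \<noteq> {}"
    and two: "\<And>i j. (i, j) \<in> S \<Longrightarrow>
      \<exists>(i', j') \<in> S. (i', j') \<noteq> (i, j) \<and> u * i' + v * j' \<ge> u * i + v * j"
  shows "has_face S u v"
proof -
  define f where "f = (\<lambda>(i, j). u * i + v * j)"
  obtain x where x: "x \<in> S" "\<And>z. z \<in> S \<Longrightarrow> f z \<le> f x"
    using Max_in[of "f ` S"] Max_ge[of "f ` S"] assms(1,2) by (metis (no_types, lifting) finite_imageI image_iff image_is_empty)
  obtain i j where ij: "x = (i, j)" by force
  obtain i' j' where "(i', j') \<in> S" "(i', j') \<noteq> (i, j)" "u * i' + v * j' \<ge> u * i + v * j"
    using two[of i j] x(1) ij by auto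
  moreover from this have "u * i + v * j = u * i' + v * j'"
    using x(2)[of "(i', j')"] ij by (auto simp: f_def)
  ultimately show ?thesis
    unfolding has_face_def using x ij by (fastforce simp: f_def)
qed

text \<open>Inside the box two lattice points on a line with normal \<open>(p, \<plusminus>1)\<close> are one primitive step
  apart, because \<open>2 p > p + 1\<close>.\<close>

lemma has_face_steep:
  fixes p s v :: int
  assumes p: "p \<ge> 3" and box: "S \<subseteq> {0..p+1} \<times> {0..p+1}" and sv: "s \<in> {1, -1}" "v \<in> {1, -1}"
    and face: "has_face S (s * p) v"
  obtains k l where "(k, l) \<in> S" "(k + 1, l - s * v * p) \<in> S"
    "\<And>a b. (a, b) \<in> S \<Longrightarrow> s * p * a + v * b \<le> s * p * k + v * l"
proof -
  obtain i j i' j' where h: "(i, j) \<in> S" "(i', j') \<in> S" "(i, j) \<noteq> (i', j')"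
     "s * p * i + v * j = s * p * i' + v * j'" "\<And>a b. (a, b) \<in> S \<Longrightarrow> s * p * a + v * b \<le> s * p * i + v * j"
    using face unfolding has_face_def by fast
  have b: "0 \<le> j" "j \<le> p + 1" "0 \<le> j'" "j' \<le> p + 1" using h(1,2) box by auto
  have eq: "p * (i - i') = s * v * (j' - j)"
    using h(4) sv by (auto simp: algebra_simps)
  hence "\<bar>p * (i - i')\<bar> \<le> p + 1" using sv b by auto
  hence "p * \<bar>i - i'\<bar> \<le> p + 1" using p by (simp add: abs_mult)
  hence "p * \<bar>i - i'\<bar> < p * 2" using p by linarith
  hence "\<bar>i - i'\<bar> < 2" using p by (simp only: mult_less_cancel_left)
  moreover have "i \<noteq> i'" using eq h(3) sv by auto
  ultimately consider "i' = i + 1" | "i = i' + 1" by linarith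
  thus ?thesis
  proof cases
    case 1
    hence "j' = j - s * v * p" using eq sv by auto
    thus ?thesis using that[of i j] h 1 by simp
  next
    case 2
    hence "j = j' - s * v * p" using eq sv by auto
    thus ?thesis using that[of i' j'] h 2 by simp
  qed
qed

text \<open>Reflection in the diagonal turns this into the steep case.\<close>

lemma has_face_flat:
  fixes p s v :: int
  assumes p: "p \<ge> 3" and box: "S \<subseteq> {0..p+1} \<times> {0..p+1}" and sv: "s \<in> {1, -1}" "v \<in> {1, -1}"
    and face: "has_face S v (s * p)"
  obtains k l where "(k, l) \<in> S" "(k - s * v * p, l + 1) \<in> S"
    "\<And>a b. (a, b) \<in> S \<Longrightarrow> v * a + s * p * b \<le> v * k + s * p * l"
proof -
  have "has_face (prod.swap ` S) (s * p) v"
    using face unfolding has_face_def by (force simp: add.commute)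
  moreover have "prod.swap ` S \<subseteq> {0..p+1} \<times> {0..p+1}" using box by auto
  ultimately obtain k l where kl: "(k, l) \<in> prod.swap ` S" "(k + 1, l - s * v * p) \<in> prod.swap ` S"
    "\<And>a b. (a, b) \<in> prod.swap ` S \<Longrightarrow> s * p * a + v * b \<le> s * p * k + v * l"
    using has_face_steep[OF p _ sv] by blast
  show ?thesis
  proof (rule that[of l k])
    show "v * a + s * p * b \<le> v * l + s * p * k" if "(a, b) \<in> S" for a b
      using kl(3)[of b a] that by (force simp: add.commute)
  qed (use kl in auto)
qed

text \<open>Since \<open>p \<ge> 2\<close>, the bounds chain to \<open>4 * a \<le> a\<close>. With
  \<open>a\<close> and \<open>b\<close> the coordinate differences of two edge endpoints, this makes
  the edges meet.\<close>

lemma mutual_multiple_le_zero: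
  fixes p a b :: int
  assumes "p \<ge> 2" "p * a \<le> b" "p * b \<le> a" "a \<ge> 0"
  shows "a = 0 \<and> b = 0"
proof -
  have "2 * a \<le> p * a" using assms by (intro mult_right_mono) auto
  hence "2 * a \<le> b" "b \<ge> 0" using assms by linarith+
  have "2 * b \<le> p * b" using assms \<open>b \<ge> 0\<close> by (intro mult_right_mono) auto
  thus ?thesis using assms \<open>2 * a \<le> b\<close> by linarith
qed

text \<open>The edges close up to the quadrilateral with vertices \<open>(p, p)\<close>,
  \<open>(p + 1, 0)\<close>, \<open>(1, 1)\<close>, \<open>(0, p + 1)\<close>: the two maximising
  edges meet at \<open>(p, p)\<close> and the two minimising ones at \<open>(1, 1)\<close>.\<close>

lemma newton_polygon_same_sign:
  fixes p :: int
  assumes p: "p \<ge> 3" and box: "S \<subseteq> {0..p+1} \<times> {0..p+1}"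
    and faces: "has_face S p 1" "has_face S (- p) (- 1)" "has_face S 1 p" "has_face S (- 1) (- p)"
  shows "(p + 1, 0) \<in> S" "(0, p + 1) \<in> S"
    and "\<And>a b. (a, b) \<in> S \<Longrightarrow> p * a + b \<le> p * (p + 1)" "\<And>a b. (a, b) \<in> S \<Longrightarrow> a + p * b \<le> p * (p + 1)"
    and "\<And>a b. (a, b) \<in> S \<Longrightarrow> p * a + b \<ge> p + 1" "\<And>a b. (a, b) \<in> S \<Longrightarrow> a + p * b \<ge> p + 1"
proof -
  have f: "has_face S (1 * p) 1" "has_face S (- 1 * p) (- 1)" "has_face S 1 (1 * p)" "has_face S (- 1) (- 1 * p)"
    using faces by simp_all
  obtain k l where kl: "(k, l) \<in> S" "(k + 1, l - p) \<in> S"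
    and kl_max: "\<And>a b. (a, b) \<in> S \<Longrightarrow> p * a + b \<le> p * k + l"
    using has_face_steep[OF p box _ _ f(1)] by auto
  obtain i j where ij: "(i, j) \<in> S" "(i - p, j + 1) \<in> S"
    and ij_max: "\<And>a b. (a, b) \<in> S \<Longrightarrow> a + p * b \<le> i + p * j"
    using has_face_flat[OF p box _ _ f(3)] by auto
  have b: "k \<le> p" "l \<ge> p" "j \<le> p" "i \<ge> p" using kl ij box by auto
  \<comment> \<open>An endpoint of each edge is tested against the maximal weight of the other; the
    box then leaves only \<open>(p, p)\<close> as the common endpoint.\<close>
  have "i - k = 0 \<and> l - j = 0"
    using kl_max[OF ij(1)] ij_max[OF kl(1)] p b
    by (intro mutual_multiple_le_zero[of p]) (auto simp: algebra_simps)
  hence v: "k = p" "i = p" "l = p" "j = p" using b by auto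
  show "(p + 1, 0) \<in> S" "(0, p + 1) \<in> S" using kl ij v by auto
  show "\<And>a b. (a, b) \<in> S \<Longrightarrow> p * a + b \<le> p * (p + 1)" "\<And>a b. (a, b) \<in> S \<Longrightarrow> a + p * b \<le> p * (p + 1)"
    using kl_max ij_max v by (auto simp: algebra_simps)
  obtain m n where mn: "(m, n) \<in> S" "(m + 1, n - p) \<in> S"
    and mn_max: "\<And>a b. (a, b) \<in> S \<Longrightarrow> - (p * a) - b \<le> - (p * m) - n"
    using has_face_steep[OF p box _ _ f(2)] by auto
  have mn_min: "p * a + b \<ge> p * m + n" if "(a, b) \<in> S" for a b
    using mn_max[OF that] by linarith
  obtain g h where gh: "(g, h) \<in> S" "(g - p, h + 1) \<in> S"
    and gh_max: "\<And>a b. (a, b) \<in> S \<Longrightarrow> - a - p * b \<le> - g - p * h"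
    using has_face_flat[OF p box _ _ f(4)] by auto
  have gh_min: "a + p * b \<ge> g + p * h" if "(a, b) \<in> S" for a b
    using gh_max[OF that] by linarith
  have b': "m \<ge> 0" "n - p \<le> 1" "h \<ge> 0" "g - p \<le> 1" using mn gh box by auto
  \<comment> \<open>The same comparison for the minima, now at the endpoints
    \<open>(m + 1, n - p)\<close> and \<open>(g - p, h + 1)\<close>, which the box forces to
    \<open>(1, 1)\<close>.\<close>
  have "(m + 1) - (g - p) = 0 \<and> (h + 1) - (n - p) = 0"
    using mn_min[OF gh(2)] gh_min[OF mn(2)] p b'
    by (intro mutual_multiple_le_zero[of p]) (auto simp: algebra_simps)
  hence v': "m = 0" "g = p + 1" "h = 0" "n = p + 1" using b' by auto
  show "\<And>a b. (a, b) \<in> S \<Longrightarrow> p * a + b \<ge> p + 1" "\<And>a b. (a, b) \<in> S \<Longrightarrow> a + p * b \<ge> p + 1"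
    using mn_min gh_min v' by auto
qed

text \<open>The steps \<open>(1, p)\<close> and \<open>(- p, 1)\<close> are perpendicular, and the
  edges form the square with vertices \<open>(p, 0)\<close>, \<open>(p + 1, p)\<close>,
  \<open>(1, p + 1)\<close>, \<open>(0, 1)\<close>.\<close>

lemma newton_polygon_opposite_sign:
  fixes p :: int
  assumes p: "p \<ge> 3" and box: "S \<subseteq> {0..p+1} \<times> {0..p+1}"
    and faces: "has_face S p (- 1)" "has_face S (- p) 1" "has_face S 1 p" "has_face S (- 1) (- p)"
  shows "(p + 1, p) \<in> S" "(0, 1) \<in> S" "(1, p + 1) \<in> S" "(p, 0) \<in> S"
    and "\<And>a b. (a, b) \<in> S \<Longrightarrow> p * a - b \<le> p * p" "\<And>a b. (a, b) \<in> S \<Longrightarrow> a + p * b \<le> p * p + p + 1"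
    and "\<And>a b. (a, b) \<in> S \<Longrightarrow> p * a - b \<ge> - 1" "\<And>a b. (a, b) \<in> S \<Longrightarrow> a + p * b \<ge> p"
proof -
  have f: "has_face S (1 * p) (- 1)" "has_face S (- 1 * p) 1" "has_face S 1 (1 * p)" "has_face S (- 1) (- 1 * p)"
    using faces by simp_all
  obtain k l where kl: "(k, l) \<in> S" "(k + 1, l + p) \<in> S"
    and kl_max: "\<And>a b. (a, b) \<in> S \<Longrightarrow> p * a - b \<le> p * k - l"
    using has_face_steep[OF p box _ _ f(1)] by auto
  obtain i j where ij: "(i, j) \<in> S" "(i - p, j + 1) \<in> S"
    and ij_max: "\<And>a b. (a, b) \<in> S \<Longrightarrow> a + p * b \<le> i + p * j"
    using has_face_flat[OF p box _ _ f(3)] by auto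
  obtain m n where mn: "(m, n) \<in> S" "(m + 1, n + p) \<in> S"
    and mn_max: "\<And>a b. (a, b) \<in> S \<Longrightarrow> b - p * a \<le> n - p * m"
    using has_face_steep[OF p box _ _ f(2)] by auto
  have mn_min: "p * a - b \<ge> p * m - n" if "(a, b) \<in> S" for a b
    using mn_max[OF that] by linarith
  obtain g h where gh: "(g, h) \<in> S" "(g - p, h + 1) \<in> S"
    and gh_max: "\<And>a b. (a, b) \<in> S \<Longrightarrow> - a - p * b \<le> - g - p * h"
    using has_face_flat[OF p box _ _ f(4)] by auto
  have gh_min: "a + p * b \<ge> g + p * h" if "(a, b) \<in> S" for a b
    using gh_max[OF that] by linarith
  have b: "k \<ge> 0" "k \<le> p" "l \<ge> 0" "l \<le> 1" "i \<ge> p" "i \<le> p + 1" "j \<ge> 0" "j \<le> p"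
    "m \<ge> 0" "m \<le> p" "n \<ge> 0" "n \<le> 1" "g \<ge> p" "g \<le> p + 1" "h \<ge> 0" "h \<le> p"
    using kl ij mn gh box by auto
  \<comment> \<open>The counterpart of \<open>mutual_multiple_le_zero\<close> for perpendicular
    edges: the signs clash unless both differences vanish.\<close>
  have flat: "x = 0 \<and> y = 0" if "p * y \<le> x" "p * x \<le> - y" "y \<ge> 0" for x y
  proof -
    have "p * y \<ge> 0" using p that by simp
    hence "x \<ge> 0" using that by linarith
    hence "p * x \<ge> 0" using p by simp
    hence "y = 0" using that by linarith
    hence "p * x \<le> 0" using that by simp
    thus ?thesis using p \<open>x \<ge> 0\<close> \<open>y = 0\<close> by (simp add: mult_le_0_iff)
  qed
  have "i - (k + 1) = 0 \<and> l + p - j = 0"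
    using kl_max[OF ij(1)] ij_max[OF kl(2)] b by (intro flat) (auto simp: algebra_simps)
  hence v: "k = i - 1" "l = 0" "j = p" using b by auto
  have "m - (g - p) = 0 \<and> h + 1 - n = 0"
    using mn_min[OF gh(2)] gh_min[OF mn(1)] b by (intro flat) (auto simp: algebra_simps)
  hence v': "m = g - p" "n = 1" "h = 0" using b by auto
  \<comment> \<open>The box leaves \<open>p\<close> and \<open>p + 1\<close> for \<open>i\<close>.
    With \<open>i = p\<close> the point \<open>(0, p + 1)\<close> would undercut the minimum of
    \<open>p * a - b\<close>.\<close>
  have "i = p + 1"
  proof (rule ccontr)
    assume "i \<noteq> p + 1"
    hence "i = p" using b by auto
    hence "p * m - n \<le> - (p + 1)" using mn_min[OF ij(2)] v by simp
    moreover have "p * m \<ge> 0" using b p by simp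
    ultimately show False using b p by linarith
  qed
  \<comment> \<open>With \<open>g = p + 1\<close> the point \<open>(p + 1, 0)\<close> would exceed
    the maximum of \<open>p * a - b\<close>.\<close>
  moreover have "g = p"
  proof (rule ccontr)
    assume "g \<noteq> p"
    hence "g = p + 1" using b by auto
    hence "p * (p + 1) \<le> p * k - l" using kl_max[OF gh(1)] v' by simp
    moreover have "p * k \<le> p * p" using b p by (intro mult_left_mono) auto
    ultimately show False using v p by (simp add: algebra_simps)
  qed
  ultimately show "(p + 1, p) \<in> S" "(0, 1) \<in> S" "(1, p + 1) \<in> S" "(p, 0) \<in> S"
    and "\<And>a b. (a, b) \<in> S \<Longrightarrow> p * a - b \<le> p * p" "\<And>a b. (a, b) \<in> S \<Longrightarrow> a + p * b \<le> p * p + p + 1"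
    and "\<And>a b. (a, b) \<in> S \<Longrightarrow> p * a - b \<ge> - 1" "\<And>a b. (a, b) \<in> S \<Longrightarrow> a + p * b \<ge> p"
    using kl ij mn gh kl_max ij_max mn_min gh_min v v' by (auto simp: algebra_simps)
qed

section \<open>The modular equation\<close>

text \<open>A point of maximal weight cannot be the only one, by
  \<open>top_weight_not_unique\<close>. The real factor \<open>\<kappa>\<close> is split off to
  leave an integral normal; being positive, it cancels from comparisons of weights.\<close>

lemma modular_equation_l_face:
  fixes p :: nat and u v :: int and \<kappa> :: real and \<tau> :: "real \<Rightarrow> complex"
  assumes L: "modular_equation_l p L" and p: "p > 0" and \<kappa>: "\<kappa> > 0"
    and \<tau>: "\<And>y. y > 0 \<Longrightarrow> Im (\<tau> y) > 0"
    and X: "((\<lambda>y. y * ln (norm (rr_l (\<tau> y)))) \<longlongrightarrow> \<kappa> * u) (at_right 0)"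
    and Y: "((\<lambda>y. y * ln (norm (rr_l (of_nat p * \<tau> y)))) \<longlongrightarrow> \<kappa> * v) (at_right 0)"
  shows "has_face {(int i, int j) | i j. coeff2 L i j \<noteq> 0} u v"
proof (rule has_faceI)
  let ?S = "{(int i, int j) | i j. coeff2 L i j \<noteq> 0}" and ?A = "{..p+1} \<times> {..p+1}"
  have deg: "degree L \<le> p + 1" "\<And>j. degree (coeff L j) \<le> p + 1" and "L \<noteq> 0"
    using L by (auto simp: modular_equation_l_def)
  have A: "(i, j) \<in> ?A" if "coeff2 L i j \<noteq> 0" for i j
    using that deg(1) deg(2)[of j] le_degree[of L j] le_degree[of "coeff L j" i]
    by (fastforce simp: coeff2_def)
  have "?S \<subseteq> (\<lambda>(i, j). (int i, int j)) ` ?A" using A by auto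
  thus "finite ?S" by (rule finite_subset) auto
  \<comment> \<open>The leading coefficient of the leading coefficient shows that the support is
    nonempty.\<close>
  have "coeff2 L (degree (lead_coeff L)) (degree L) \<noteq> 0"
    using \<open>L \<noteq> 0\<close> by (simp add: coeff2_def)
  thus "?S \<noteq> {}" by blast
  show "\<exists>(i', j') \<in> ?S. (i', j') \<noteq> (i, j) \<and> u * i' + v * j' \<ge> u * i + v * j" if ij_S: "(i, j) \<in> ?S" for i j
  proof -
    obtain i0 j0 where ij: "i = int i0" "j = int j0" "coeff2 L i0 j0 \<noteq> 0" using ij_S by auto
    have "\<exists>(i1, j1) \<in> ?A. (of_rat (coeff2 L i1 j1) :: complex) \<noteq> 0 \<and> (i1, j1) \<noteq> (i0, j0) \<and>
            \<kappa> * u * i1 + \<kappa> * v * j1 \<ge> \<kappa> * u * i0 + \<kappa> * v * j0"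
    proof (rule top_weight_not_unique[OF _ A[OF ij(3)] _ X Y])
      fix y :: real assume y: "y > 0"
      show "rr_l (\<tau> y) \<noteq> 0 \<and> rr_l (of_nat p * \<tau> y) \<noteq> 0"
        using \<tau>[OF y] p by (intro conjI rr_l_nonzero) auto
      have "eval2 L (rr_l (\<tau> y)) (rr_l (of_nat p * \<tau> y)) = 0"
        using L \<tau>[OF y] by (simp add: modular_equation_l_def)
      thus "(\<Sum>(i, j) \<in> ?A. of_rat (coeff2 L i j) * rr_l (\<tau> y) ^ i * rr_l (of_nat p * \<tau> y) ^ j) = 0"
        by (simp only: eval2_conv_sum[OF deg])
    qed (use ij in auto)
    then obtain i1 j1 where h: "coeff2 L i1 j1 \<noteq> 0" "(i1, j1) \<noteq> (i0, j0)"
      "\<kappa> * u * i1 + \<kappa> * v * j1 \<ge> \<kappa> * u * i0 + \<kappa> * v * j0" by auto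
    have "\<kappa> * of_int (u * int i0 + v * int j0) \<le> \<kappa> * of_int (u * int i1 + v * int j1)"
      using h(3) by (simp add: algebra_simps)
    hence "u * int i0 + v * int j0 \<le> u * int i1 + v * int j1"
      using \<kappa> by (simp only: mult_le_cancel_left_pos of_int_le_iff)
    thus ?thesis using h(1,2) ij by (intro bexI[of _ "(int i1, int j1)"]) auto
  qed
qed

text \<open>Put \<open>K = 5 / 2 * rr_growth\<close>. Towards \<open>b / 5\<close> the two growth
  rates are \<open>K e\<close> and \<open>K s e / p\<close>; towards \<open>b / (5 p)\<close> they
  are \<open>K e / p^2\<close> and \<open>K e / p\<close>. Clearing denominators gives the two
  normals.\<close>

lemma modular_equation_l_faces:
  fixes p :: nat and s e b :: int
  assumes L: "modular_equation_l p L" and p: "odd p"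
    and s: "twists_gauss5 (int p) s" and e: "twists_gauss5 b e" and cop: "coprime b (int p)"
  shows "has_face {(int i, int j) | i j. coeff2 L i j \<noteq> 0} (e * int p) (s * e)"
    and "has_face {(int i, int j) | i j. coeff2 L i j \<noteq> 0} e (e * int p)"
proof -
  have p0: "p > 0" using p by (cases p) auto
  note K = rr_growth_pos
  have tw: "twists_gauss5 (int p * b) (s * e)" using twists_gauss5_mult[OF s e] by simp
  show "has_face {(int i, int j) | i j. coeff2 L i j \<noteq> 0} (e * int p) (s * e)"
  proof (rule modular_equation_l_face[OF L p0, where \<kappa> = "5 / 2 * rr_growth / p"
      and \<tau> = "\<lambda>y. of_real (b / (5 * real 1)) + \<i> * of_real (1 * y)"])
    show "((\<lambda>y. y * ln (norm (rr_l (of_real (b / (5 * real 1)) + \<i> * of_real (1 * y))))) \<longlongrightarrow>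
        5 / 2 * rr_growth / p * of_int (e * int p)) (at_right 0)"
      using rr_l_cusp_growth[of 1 b e 1] e p0 by (simp add: mult.assoc)
    \<comment> \<open>Multiplication by \<open>p\<close> changes the numerator to
      \<open>p * b\<close>, with symbol \<open>s * e\<close>, and speeds up the approach by
      \<open>p\<close>.\<close>
    have "of_nat p * (of_real (b / (5 * real 1)) + \<i> * of_real (1 * y)) =
        of_real (of_int (int p * b) / (5 * real 1)) + \<i> * of_real (real p * y)" for y
      by (simp add: algebra_simps)
    thus "((\<lambda>y. y * ln (norm (rr_l (of_nat p * (of_real (b / (5 * real 1)) + \<i> * of_real (1 * y)))))) \<longlongrightarrow>
        5 / 2 * rr_growth / p * of_int (s * e)) (at_right 0)"
      using rr_l_cusp_growth[of 1 "int p * b" "of_int (s * e)" "real p"] tw p0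
      by (simp only:) simp
  qed (use K p0 in auto)
  show "has_face {(int i, int j) | i j. coeff2 L i j \<noteq> 0} e (e * int p)"
  proof (rule modular_equation_l_face[OF L p0, where \<kappa> = "5 / 2 * rr_growth / p ^ 2"
      and \<tau> = "\<lambda>y. of_real (b / (5 * real p)) + \<i> * of_real (1 * y)"])
    \<comment> \<open>Oddness of \<open>p\<close> keeps the doubled numerator prime to the
      denominator.\<close>
    have "coprime (2 * b) (int p)" using p cop by simp
    thus "((\<lambda>y. y * ln (norm (rr_l (of_real (b / (5 * real p)) + \<i> * of_real (1 * y))))) \<longlongrightarrow>
        5 / 2 * rr_growth / p ^ 2 * of_int e) (at_right 0)"
      using rr_l_cusp_growth[of p b e 1] e p0 by simp
    \<comment> \<open>Here multiplication by \<open>p\<close> cancels the denominator, so the image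
      curve has \<open>d = 1\<close>.\<close>
    have "of_nat p * (of_real (b / (5 * real p)) + \<i> * of_real (1 * y)) =
        of_real (b / (5 * real 1)) + \<i> * of_real (real p * y)" for y
      using p0 by (simp add: field_simps)
    thus "((\<lambda>y. y * ln (norm (rr_l (of_nat p * (of_real (b / (5 * real p)) + \<i> * of_real (1 * y)))))) \<longlongrightarrow>
        5 / 2 * rr_growth / p ^ 2 * of_int (e * int p)) (at_right 0)"
      using rr_l_cusp_growth[of 1 b e "real p"] e p0
      by (simp only:) (simp add: power2_eq_square mult.assoc)
  qed (use K p0 in auto)
qed

theorem theorem4p7:
  fixes p :: nat and L :: "rat poly poly" and C :: "nat \<Rightarrow> nat \<Rightarrow> rat"
  assumes "prime p" and "odd p" and "p \<noteq> 5"
    and "modular_equation_l p L"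
    and C_def: "\<And>i j. C i j = coeff2 L i j"
  shows "([int p = 1] (mod 10) \<or> [int p = - 1] (mod 10) \<longrightarrow>
            C (p + 1) 0 \<noteq> 0 \<and> C 0 (p + 1) \<noteq> 0 \<and>
            (\<forall>i \<in> {1..p + 1}. C i (p + 1) = 0 \<and> C (p + 1) i = 0) \<and>
            (\<forall>j \<in> {0..p}. C 0 j = 0 \<and> C j 0 = 0)) \<and>
         ([int p = 3] (mod 10) \<or> [int p = - 3] (mod 10) \<longrightarrow>
            C (p + 1) p \<noteq> 0 \<and> C 0 1 \<noteq> 0 \<and> C 1 (p + 1) \<noteq> 0 \<and> C p 0 \<noteq> 0 \<and>
            (\<forall>i \<in> {0..p - 1} \<union> {p + 1}. C (p + 1) i = 0 \<and> C i 0 = 0) \<and>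
            (\<forall>j \<in> {0} \<union> {2..p + 1}. C 0 j = 0 \<and> C j (p + 1) = 0))"
proof -
  define S where "S = {(int i, int j) | i j. coeff2 L i j \<noteq> 0}"
  have mem: "(int i, int j) \<in> S \<longleftrightarrow> C i j \<noteq> 0" for i j
    by (auto simp: S_def C_def)
  have p3: "int p \<ge> 3"
    using assms(1,2) prime_ge_2_nat[of p] by (cases "p = 2") auto
  have cop: "coprime 2 (int p)" using assms(2) by simp
  have deg: "degree L \<le> p + 1" "\<And>j. degree (coeff L j) \<le> p + 1"
    using assms(4) by (auto simp: modular_equation_l_def)
  have box: "S \<subseteq> {0..int p + 1} \<times> {0..int p + 1}"
  proof
    fix x assume "x \<in> S"
    then obtain i j where ij: "x = (int i, int j)" "coeff (coeff L j) i \<noteq> 0"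
      by (auto simp: S_def coeff2_def)
    hence "i \<le> p + 1" "j \<le> p + 1"
      using deg(1) deg(2)[of j] le_degree[of L j] le_degree[of "coeff L j" i] by fastforce+
    thus "x \<in> {0..int p + 1} \<times> {0..int p + 1}" using ij by auto
  qed
  \<comment> \<open>The numerators 1 and 2 have opposite symbols and so give opposite
    normals.\<close>
  have faces: "has_face S (int p) s" "has_face S (- int p) (- s)" "has_face S 1 (int p)" "has_face S (- 1) (- int p)"
    if s: "twists_gauss5 (int p) s" for s :: int
    using modular_equation_l_faces[OF assms(4,2) s, of 1 1] twists_gauss5_1
      modular_equation_l_faces[OF assms(4,2) s, of 2 "- 1"] twists_gauss5_2 cop
    by (simp_all add: S_def)
  show ?thesis
  proof (intro conjI impI)
    assume "[int p = 1] (mod 10) \<or> [int p = - 1] (mod 10)"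
    hence "[int p = 1] (mod 5) \<or> [int p = - 1] (mod 5)"
      using cong_dvd_modulus[of "int p" _ 10 5] by auto
    hence "twists_gauss5 (int p) (of_int 1)"
      using twists_gauss5_cong[OF twists_gauss5_1] twists_gauss5_cong[OF twists_gauss5_uminus[OF twists_gauss5_1]]
      by auto
    note N = newton_polygon_same_sign[OF p3 box faces[OF this]]
    show "C (p + 1) 0 \<noteq> 0" "C 0 (p + 1) \<noteq> 0"
      using N(1,2) mem[of "p + 1" 0] mem[of 0 "p + 1"] by (simp_all add: add.commute)
    \<comment> \<open>Each of these exponent pairs violates one of the edge inequalities.\<close>
    show "\<forall>i \<in> {1..p + 1}. C i (p + 1) = 0 \<and> C (p + 1) i = 0"
    proof (intro ballI conjI)
      fix i assume i: "i \<in> {1..p + 1}"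
      show "C i (p + 1) = 0" using N(4)[of "int i" "int (p + 1)"] i mem[of i "p + 1"] by (auto simp: algebra_simps)
      show "C (p + 1) i = 0" using N(3)[of "int (p + 1)" "int i"] i mem[of "p + 1" i] by (auto simp: algebra_simps)
    qed
    show "\<forall>j \<in> {0..p}. C 0 j = 0 \<and> C j 0 = 0"
    proof (intro ballI conjI)
      fix j assume j: "j \<in> {0..p}"
      show "C 0 j = 0" using N(5)[of 0 "int j"] j mem[of 0 j] by auto
      show "C j 0 = 0" using N(6)[of "int j" 0] j mem[of j 0] by auto
    qed
  next
    assume "[int p = 3] (mod 10) \<or> [int p = - 3] (mod 10)"
    hence "[int p = 3] (mod 5) \<or> [int p = - 3] (mod 5)"
      using cong_dvd_modulus[of "int p" _ 10 5] by auto
    \<comment> \<open>Modulo 5, \<open>3\<close> is \<open>- 2\<close> and \<open>- 3\<close> is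
      \<open>2\<close>, so the symbol is -1.\<close>
    hence "[int p = - 2] (mod 5) \<or> [int p = 2] (mod 5)"
      by (auto simp: cong_def)
    hence "twists_gauss5 (int p) (of_int (- 1))"
      using twists_gauss5_cong[OF twists_gauss5_2] twists_gauss5_cong[OF twists_gauss5_uminus[OF twists_gauss5_2]]
      by auto
    note F = faces[OF this]
    have F2: "has_face S (- int p) 1" using F(2) by simp
    note N = newton_polygon_opposite_sign[OF p3 box F(1) F2 F(3,4)]
    show "C (p + 1) p \<noteq> 0" "C 0 1 \<noteq> 0" "C 1 (p + 1) \<noteq> 0" "C p 0 \<noteq> 0"
      using N(1-4) mem[of "p + 1" p] mem[of 0 1] mem[of 1 "p + 1"] mem[of p 0] by (simp_all add: add.commute)
    \<comment> \<open>Each side of the box touches the square in a single vertex, pinned down by two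
      edge inequalities.\<close>
    show "\<forall>i \<in> {0..p - 1} \<union> {p + 1}. C (p + 1) i = 0 \<and> C i 0 = 0"
    proof (intro ballI conjI)
      fix i assume i: "i \<in> {0..p - 1} \<union> {p + 1}"
      \<comment> \<open>Subtraction on \<open>nat\<close> truncates; \<open>p \<ge> 3\<close>
        ensures that \<open>{0..p - 1}\<close> misses \<open>p\<close>.\<close>
      hence ip: "i \<noteq> p" using p3 by auto
      show "C (p + 1) i = 0"
      proof (rule ccontr)
        assume "C (p + 1) i \<noteq> 0"
        hence m: "(int (p + 1), int i) \<in> S" by (simp only: mem not_False_eq_True)
        have "int p * int i \<le> int p * int p" using N(6)[OF m] by simp
        hence "int i \<le> int p" using p3 by (simp add: mult_le_cancel_left_pos)
        moreover have "int i \<ge> int p" using N(5)[OF m] by (simp add: algebra_simps)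
        ultimately show False using ip by simp
      qed
      show "C i 0 = 0"
      proof (rule ccontr)
        assume "C i 0 \<noteq> 0"
        hence m: "(int i, 0) \<in> S" using mem[of i 0] by simp
        have "int i \<le> int p" using N(5)[OF m] p3 by (simp add: mult_le_cancel_left_pos)
        moreover have "int i \<ge> int p" using N(8)[OF m] by simp
        ultimately show False using ip by simp
      qed
    qed
    show "\<forall>j \<in> {0} \<union> {2..p + 1}. C 0 j = 0 \<and> C j (p + 1) = 0"
    proof (intro ballI conjI)
      fix j assume j: "j \<in> {0} \<union> {2..p + 1}"
      hence j1: "j \<noteq> 1" by auto
      show "C 0 j = 0"
      proof (rule ccontr)
        assume "C 0 j \<noteq> 0"
        hence m: "(0, int j) \<in> S" using mem[of 0 j] by simp
        have "j \<le> 1" using N(7)[OF m] by simp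
        moreover have "j \<noteq> 0" using N(8)[OF m] p3 by auto
        ultimately show False using j1 by simp
      qed
      show "C j (p + 1) = 0"
      proof (rule ccontr)
        assume "C j (p + 1) \<noteq> 0"
        hence m: "(int j, int (p + 1)) \<in> S" by (simp only: mem not_False_eq_True)
        have "j \<le> 1" using N(6)[OF m] by (simp add: algebra_simps)
        moreover have "j \<noteq> 0" using N(7)[OF m] p3 by auto
        ultimately show False using j1 by simp
      qed
    qed
  qed
qed

end
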